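(* Let $c_a,\kappa,\lambda\in\mathbb{R}$ satisfy $c_a-\kappa\le 1$ and $0<\lambda\le e\,(c_a-\kappa)$, and let $\theta\in\mathbb{R}$. When a human recruits (removes) a robot that is foraging, the marginal utility $\pi(n,\theta)$ increases for all (remaining) robots; that is, for each remaining robot, if $n\ge 1$ is the number of other foraging robots before the removal, then $\pi(n-1,\theta)>\pi(n,\theta)$.
   Context: Each robot in a homogeneous team chooses an action $a\in\{0,1\}$, where $a=1$ means "forage" and $a=0$ means "idle". The real parameter $\theta$ is a global signal (urgency of the task) and, for a given robot, $n$ is the number of other robots that forage. Each robot's utility is $$u(a,n,\theta)=-(n+a)\,c_a+a\big(\kappa+\lambda e^{-(n+1)}+\theta\big),$$ and its marginal utility is $$\pi(n,\theta)=u(1,n,\theta)-u(0,n,\theta)=-c_a+\kappa+\lambda e^{-(n+1)}+\theta.$$ Removing one foraging robot lowers $n$ by one for every remaining robot, with $\theta$ unchanged. *)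

theory Defs
  imports Complex_Main
begin

definition utility :: "real \<Rightarrow> real \<Rightarrow> real \<Rightarrow> nat \<Rightarrow> nat \<Rightarrow> real \<Rightarrow> real" where
  "utility c_a \<kappa> lam a n \<theta> =
     - (real n + real a) * c_a + real a * (\<kappa> + lam * exp (- (real n + 1)) + \<theta>)"

definition marginal_utility :: "real \<Rightarrow> real \<Rightarrow> real \<Rightarrow> nat \<Rightarrow> real \<Rightarrow> real" where
  "marginal_utility c_a \<kappa> lam n \<theta> = utility c_a \<kappa> lam 1 n \<theta> - utility c_a \<kappa> lam 0 n \<theta>"

lemma marginal_utility_eq:
  "marginal_utility c_a \<kappa> lam n \<theta> = - c_a + \<kappa> + lam * exp (- (real n + 1)) + \<theta>"
  by (simp add: marginal_utility_def utility_def algebra_simps)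

text \<open>The number of foraging robots in the team \<open>R\<close> other than robot \<open>i\<close>, where
  \<open>act j\<close> is the action of robot \<open>j\<close> (1 for foraging, 0 for idling).\<close>

definition other_foragers :: "'r set \<Rightarrow> ('r \<Rightarrow> nat) \<Rightarrow> 'r \<Rightarrow> nat" where
  "other_foragers R act i = card {j \<in> R - {i}. act j = 1}"

end

theory Submission
  imports Defs
begin

text \<open>By \<open>marginal_utility_eq\<close>, n enters only through
  \<open>lam * exp (- (real n + 1))\<close>, strictly decreasing as lam > 0
  (\<open>marginal_utility_decreasing\<close>). Each remaining robot counts r exactly once among its
  foraging peers, so removing r lowers n by one (\<open>other_foragers_remove\<close>).\<close>

lemma marginal_utility_decreasing:
  assumes "0 < lam" and "m < n"
  shows "marginal_utility c_a \<kappa> lam n \<theta> < marginal_utility c_a \<kappa> lam m \<theta>"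
  using assms by (simp add: marginal_utility_eq)

lemma other_foragers_remove:
  assumes "r \<in> R" and "act r = 1" and "i \<noteq> r"
  shows "other_foragers (R - {r}) act i = other_foragers R act i - 1"
proof -
  have "{j \<in> R - {r} - {i}. act j = 1} = {j \<in> R - {i}. act j = 1} - {r}"
    by blast
  moreover have "r \<in> {j \<in> R - {i}. act j = 1}"
    using assms by simp
  \<comment> \<open>If the set is infinite, both cards are 0 and 0 - 1 = 0 on naturals.\<close>
  ultimately show ?thesis
    by (simp only: other_foragers_def card_Diff_singleton)
qed

theorem lemma3:
  fixes c_a \<kappa> lam \<theta> :: real
    and R :: "'r set" and act :: "'r \<Rightarrow> nat" and r :: 'r
  assumes "c_a - \<kappa> \<le> 1"
    and "0 < lam" and "lam \<le> exp 1 * (c_a - \<kappa>)"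
    and "finite R" and "\<forall>i\<in>R. act i \<in> {0, 1}"
    and "r \<in> R" and "act r = 1"
  shows "\<forall>i \<in> R - {r}. \<forall>n \<ge> 1. other_foragers R act i = n \<longrightarrow>
           other_foragers (R - {r}) act i = n - 1 \<and>
           marginal_utility c_a \<kappa> lam (n - 1) \<theta> > marginal_utility c_a \<kappa> lam n \<theta>"
  \<comment> \<open>The bound n \<ge> 1 makes the truncated n - 1 strictly smaller than n.\<close>
  using assms by (auto simp: other_foragers_remove intro!: marginal_utility_decreasing)

end
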